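(* Let $f:[0,1]\to\mathbb{R}$ be a continuous function. Then $$f(\nu)+\lim_{N\to\infty}\sum_{j=1}^{N}A_j(\nu)\,\Delta_jf(\nu;0,1)= (1-\nu)f(0)+\nu f(1),$$ where the limit is uniform in $\nu\in[0,1]$.
   Context: $[\cdot]$ denotes the integer part (floor). For $0\le\nu\le 1$ and $j\in\{1,2,3,\dots\}$ let $k_j(\nu)=[2^{j-1}\nu]$, $r_j(\nu)=[2^{j}\nu]$ and $$A_j(\nu)=(-1)^{r_j(\nu)}2^{j-1}\nu+(-1)^{r_j(\nu)+1}\left[\frac{r_j(\nu)+1}{2}\right].$$ For $f:[0,1]\to\mathbb{R}$ let $$\Delta_jf(\nu;0,1)=f\left(\tfrac{k_j(\nu)}{2^{j-1}}\right)+f\left(\tfrac{k_j(\nu)+1}{2^{j-1}}\right)-2f\left(\tfrac{2k_j(\nu)+1}{2^{j}}\right),$$ with the convention that $f(x)=0$ for $x\notin[0,1]$ (points outside $[0,1]$ occur only when $\nu=1$). *)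

theory Defs
  imports "HOL-Analysis.Analysis"
begin

text \<open>
  The index \<open>j\<close> ranges over \<open>1, 2, 3, \<dots>\<close> throughout, so the truncated subtraction in
  \<open>j - 1\<close> is the ordinary one; the values at \<open>j = 0\<close> are irrelevant.
\<close>

definition k_idx :: "nat \<Rightarrow> real \<Rightarrow> int" where
  "k_idx j \<nu> = \<lfloor>2 ^ (j - 1) * \<nu>\<rfloor>"

definition r_idx :: "nat \<Rightarrow> real \<Rightarrow> int" where
  "r_idx j \<nu> = \<lfloor>2 ^ j * \<nu>\<rfloor>"

definition A_coeff :: "nat \<Rightarrow> real \<Rightarrow> real" where
  "A_coeff j \<nu> =
     (- 1) powi (r_idx j \<nu>) * 2 ^ (j - 1) * \<nu>
     + (- 1) powi (r_idx j \<nu> + 1) * of_int \<lfloor>(of_int (r_idx j \<nu>) + 1) / 2 :: real\<rfloor>"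

text \<open>
  A function on \<open>[0,1]\<close> is represented by a total function on the reals. The zero extension
  discards its values outside \<open>[0,1]\<close>, which are otherwise used at \<open>\<nu> = 1\<close>.
\<close>

definition zero_ext :: "(real \<Rightarrow> real) \<Rightarrow> real \<Rightarrow> real" where
  "zero_ext f x = (if x \<in> {0..1} then f x else 0)"

definition Delta :: "nat \<Rightarrow> (real \<Rightarrow> real) \<Rightarrow> real \<Rightarrow> real" where
  "Delta j f \<nu> =
     zero_ext f (of_int (k_idx j \<nu>) / 2 ^ (j - 1))
     + zero_ext f ((of_int (k_idx j \<nu>) + 1) / 2 ^ (j - 1))
     - 2 * zero_ext f ((2 * of_int (k_idx j \<nu>) + 1) / 2 ^ j)"

end

theory Submission
  imports Defs
begin

text \<open>
  Let \<open>L\<^sub>n\<close> be the piecewise linear interpolant of \<open>f\<close> at the dyadic points of level \<open>n\<close>.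
  The coefficient \<open>A\<^sub>j(\<nu>)\<close> is the distance from \<open>2\<^sup>j\<^sup>-\<^sup>1 \<nu>\<close> to the nearest integer, so
  \<open>A\<^sub>j \<Delta>\<^sub>j f = L\<^sub>j\<^sub>-\<^sub>1 - L\<^sub>j\<close> and the sum telescopes to \<open>L\<^sub>0 - L\<^sub>N\<close>; by uniform continuity
  \<open>L\<^sub>N\<close> tends to \<open>f\<close> uniformly.
\<close>

text \<open>For \<nu> = 1 the right node is 1 + 1 / 2 ^ n, outside [0,1], but its weight
  \<open>frac (2 ^ n * \<nu>)\<close> is then 0.\<close>

definition dyadic_interp :: "(real \<Rightarrow> real) \<Rightarrow> nat \<Rightarrow> real \<Rightarrow> real" where
  "dyadic_interp g n \<nu> =
     (1 - frac (2 ^ n * \<nu>)) * g (of_int \<lfloor>2 ^ n * \<nu>\<rfloor> / 2 ^ n)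
     + frac (2 ^ n * \<nu>) * g ((of_int \<lfloor>2 ^ n * \<nu>\<rfloor> + 1) / 2 ^ n)"

lemma floor_double:
  fixes x :: real
  shows "\<lfloor>2 * x\<rfloor> = (if frac x < 1 / 2 then 2 * \<lfloor>x\<rfloor> else 2 * \<lfloor>x\<rfloor> + 1)"
  unfolding frac_def by (split if_split) linarith

text \<open>The parity of \<open>r_idx\<close> tells which half of its level-n cell \<nu> lies in.
  With x = 2 ^ n * \<nu> and k its floor, the even case r = 2k yields x - k and the odd case r = 2k
  + 1 yields (k + 1) - x.\<close>

lemma A_coeff_Suc:
  "A_coeff (Suc n) \<nu> = min (frac (2 ^ n * \<nu>)) (1 - frac (2 ^ n * \<nu>))"
proof -
  define x where "x = 2 ^ n * \<nu>"
  define k where "k = \<lfloor>x\<rfloor>"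
  have r: "r_idx (Suc n) \<nu> = (if frac x < 1 / 2 then 2 * k else 2 * k + 1)"
    using floor_double[of x] by (simp add: r_idx_def x_def k_def mult.assoc)
  have x: "x = of_int k + frac x"
    by (simp add: k_def frac_def)
  show ?thesis
  proof (cases "frac x < 1 / 2")
    case True
    have "\<lfloor>(of_int (2 * k) + 1) / 2 :: real\<rfloor> = k"
      by (simp add: floor_eq_iff)
    then show ?thesis
      using True r x by (simp add: A_coeff_def power_int_add flip: x_def mult.assoc)
  next
    case False
    have "\<lfloor>(of_int (2 * k + 1) + 1) / 2 :: real\<rfloor> = k + 1"
      by (simp add: floor_eq_iff)
    then show ?thesis
      using False r x by (simp add: A_coeff_def power_int_add flip: x_def mult.assoc)
  qed
qed

text \<open>On a level-n cell both interpolants agree at the endpoints, and refinement adds only the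
  midpoint as a node. Their difference is thus a tent: \<open>A_coeff\<close> is the tent of height
  1/2, and half of \<open>Delta\<close> is the gap between chord and function at the
  midpoint.\<close>

lemma A_coeff_Delta_eq:
  "A_coeff (Suc n) \<nu> * Delta (Suc n) f \<nu> =
     dyadic_interp (zero_ext f) n \<nu> - dyadic_interp (zero_ext f) (Suc n) \<nu>"
proof -
  define x where "x = 2 ^ n * \<nu>"
  define k where "k = \<lfloor>x\<rfloor>"
  define t where "t = frac x"
  have x2: "2 ^ Suc n * \<nu> = 2 * x"
    by (simp add: x_def)
  have fl: "\<lfloor>2 * x\<rfloor> = (if t < 1 / 2 then 2 * k else 2 * k + 1)"
    unfolding t_def k_def by (rule floor_double)
  then have fr: "frac (2 * x) = (if t < 1 / 2 then 2 * t else 2 * t - 1)"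
    by (auto simp: frac_def t_def k_def)
  \<comment> \<open>The fine nodes of index 2k and 2k + 2 are the endpoints of the coarse
    cell.\<close>
  have left: "(2 * of_int k :: real) / 2 ^ Suc n = of_int k / 2 ^ n"
    and right: "(2 * of_int k + 1 + 1 :: real) / 2 ^ Suc n = (of_int k + 1) / 2 ^ n"
    by (simp_all add: field_simps)
  show ?thesis
    using fl fr left right
    unfolding A_coeff_Suc Delta_def k_idx_def dyadic_interp_def x2 diff_Suc_1
      x_def[symmetric] k_def[symmetric] t_def[symmetric]
    by (cases "t < 1 / 2") (simp_all del: power_Suc, simp_all add: algebra_simps)
qed

lemma sum_A_coeff_Delta:
  "(\<Sum>j=1..N. A_coeff j \<nu> * Delta j f \<nu>) =
     dyadic_interp (zero_ext f) 0 \<nu> - dyadic_interp (zero_ext f) N \<nu>"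
  by (induction N) (simp_all add: A_coeff_Delta_eq)

lemma dyadic_interp_0:
  assumes "\<nu> \<in> {0..1}"
  shows "dyadic_interp (zero_ext f) 0 \<nu> = (1 - \<nu>) * f 0 + \<nu> * f 1"
proof (cases "\<nu> = 1")
  case False
  with assms have "\<lfloor>\<nu>\<rfloor> = 0"
    by (simp add: floor_eq_iff)
  then show ?thesis
    by (simp add: dyadic_interp_def zero_ext_def frac_def)
qed (simp add: dyadic_interp_def zero_ext_def)

text \<open>Balls are convex, so an interpolated value is close to f \<nu> once both nodal values
  are.\<close>

lemma dist_convex_comb_less:
  fixes a b c t :: real
  assumes "0 \<le> t" "t \<le> 1" "dist a c < e" "dist b c < e"
  shows "dist ((1 - t) * a + t * b) c < e"
  using convexD[OF convex_ball, of a c e b "1 - t" t] assms by (simp add: dist_commute)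

lemma uniform_limit_dyadic_interp:
  assumes "continuous_on {0..1} f"
  shows "uniform_limit {0..1} (dyadic_interp (zero_ext f)) f sequentially"
proof (rule uniform_limitI)
  fix e :: real
  assume "e > 0"
  have "uniformly_continuous_on {0..1} f"
    using assms by (intro compact_uniformly_continuous) auto
  then obtain d where "d > 0"
    and d: "\<And>x y. \<lbrakk>x \<in> {0..1}; y \<in> {0..1}; dist y x < d\<rbrakk> \<Longrightarrow> dist (f y) (f x) < e"
    using \<open>e > 0\<close> unfolding uniformly_continuous_on_def by metis
  have "(\<lambda>n. (1 / 2 :: real) ^ n) \<longlonglongrightarrow> 0"
    by (rule LIMSEQ_power_zero) simp
  then have "\<forall>\<^sub>F n in sequentially. (1 / 2 :: real) ^ n < d"
    using \<open>d > 0\<close> by (rule order_tendstoD)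
  then show "\<forall>\<^sub>F n in sequentially. \<forall>\<nu>\<in>{0..1}. dist (dyadic_interp (zero_ext f) n \<nu>) (f \<nu>) < e"
  proof eventually_elim
    case (elim n)
    then have small: "1 / 2 ^ n < d"
      by (simp add: power_one_over)
    show ?case
    proof
      fix \<nu> :: real
      assume \<nu>: "\<nu> \<in> {0..1}"
      show "dist (dyadic_interp (zero_ext f) n \<nu>) (f \<nu>) < e"
      \<comment> \<open>At 1 the right node lies outside [0,1], where continuity of f says nothing;
        but 2 ^ n is an integer, so the interpolant equals f 1 exactly.\<close>
      proof (cases "\<nu> = 1")
        case True
        have "(2 :: real) ^ n = of_int (2 ^ n)"
          by simp
        then have pow: "frac ((2 :: real) ^ n) = 0" "\<lfloor>(2 :: real) ^ n\<rfloor> = 2 ^ n"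
          by (metis frac_of_int, metis floor_of_int)
        then show ?thesis
          using True \<open>e > 0\<close> by (simp add: dyadic_interp_def zero_ext_def pow)
      next
        case False
        define k where "k = \<lfloor>2 ^ n * \<nu>\<rfloor>"
        have k: "of_int k \<le> 2 ^ n * \<nu>" "2 ^ n * \<nu> < of_int k + 1"
          unfolding k_def by linarith+
        have "0 \<le> k"
          using \<nu> by (simp add: k_def)
        \<comment> \<open>Strictness, from \<nu> < 1, is what keeps the right node k + 1 within 2 ^
          n.\<close>
        have "2 ^ n * \<nu> < of_int (2 ^ n)"
          using \<nu> False by simp
        then have "k + 1 \<le> 2 ^ n"
          unfolding k_def by (simp only: floor_less_iff zless_imp_add1_zle)
        then have "of_int (k + 1) \<le> (of_int (2 ^ n) :: real)"
          by (simp only: of_int_le_iff)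
        then have k1: "of_int k + 1 \<le> (2 :: real) ^ n"
          by simp
        have a: "of_int k / 2 ^ n \<in> {0..1 :: real}" "(of_int k + 1) / 2 ^ n \<in> {0..1 :: real}"
          using k1 \<open>k + 1 \<le> 2 ^ n\<close> \<open>0 \<le> k\<close> by simp_all
        have "of_int k / 2 ^ n \<le> \<nu>" "\<nu> < (of_int k + 1) / 2 ^ n"
          using k by (simp_all add: field_simps)
        moreover have "(of_int k + 1) / 2 ^ n = of_int k / 2 ^ n + (1 / 2 ^ n :: real)"
          by (simp add: add_divide_distrib)
        ultimately have "dist (of_int k / 2 ^ n) \<nu> < d" "dist ((of_int k + 1) / 2 ^ n) \<nu> < d"
          using small by (simp_all only: dist_real_def abs_less_iff) linarith+
        then have "dist (f (of_int k / 2 ^ n)) (f \<nu>) < e"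
          "dist (f ((of_int k + 1) / 2 ^ n)) (f \<nu>) < e"
          using a \<nu> d by blast+
        then have "dist (zero_ext f (of_int k / 2 ^ n)) (f \<nu>) < e"
          "dist (zero_ext f ((of_int k + 1) / 2 ^ n)) (f \<nu>) < e"
          using a by (simp_all only: zero_ext_def if_True)
        then show ?thesis
          unfolding dyadic_interp_def k_def
          by (intro dist_convex_comb_less frac_ge_0 less_imp_le[OF frac_lt_1])
      qed
    qed
  qed
qed

theorem proposition2p10:
  fixes f :: "real \<Rightarrow> real"
  assumes "continuous_on {0..1} f"
  shows "uniform_limit {0..1}
           (\<lambda>N \<nu>. \<Sum>j=1..N. A_coeff j \<nu> * Delta j f \<nu>)
           (\<lambda>\<nu>. lim (\<lambda>N. \<Sum>j=1..N. A_coeff j \<nu> * Delta j f \<nu>)) sequentially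
         \<and> (\<forall>\<nu>\<in>{0..1}.
              f \<nu> + lim (\<lambda>N. \<Sum>j=1..N. A_coeff j \<nu> * Delta j f \<nu>)
                = (1 - \<nu>) * f 0 + \<nu> * f 1)"
proof -
  define S where "S N \<nu> = (\<Sum>j=1..N. A_coeff j \<nu> * Delta j f \<nu>)" for N \<nu>
  define h where "h \<nu> = dyadic_interp (zero_ext f) 0 \<nu> - f \<nu>" for \<nu>
  have lim_h: "uniform_limit {0..1} S h sequentially"
    unfolding S_def h_def sum_A_coeff_Delta
    by (intro uniform_limit_minus uniform_limit_const uniform_limit_dyadic_interp assms)
  \<comment> \<open>\<open>lim\<close> is meaningful only where convergence is known, so it is
    identified with \<open>h\<close> on [0,1] only; a uniform limit over that set depends on nothing
    else.\<close>
  have lim_eq: "lim (\<lambda>N. S N \<nu>) = h \<nu>" if "\<nu> \<in> {0..1}" for \<nu>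
    using tendsto_uniform_limitI[OF lim_h that] by (rule limI)
  then have "uniform_limit {0..1} S (\<lambda>\<nu>. lim (\<lambda>N. S N \<nu>)) sequentially"
    using lim_h by (subst uniform_limit_cong'[where g = S and i = h]) auto
  moreover have "f \<nu> + lim (\<lambda>N. S N \<nu>) = (1 - \<nu>) * f 0 + \<nu> * f 1" if "\<nu> \<in> {0..1}" for \<nu>
    using lim_eq[OF that] dyadic_interp_0[OF that, of f] by (simp add: h_def)
  ultimately show ?thesis
    unfolding S_def by blast
qed

end
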